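(* Let $r\geq 3$ be an integer and let $G$ be a connected $r$-regular graph. Then $\alpha(G)=\mu(G)$ if and only if either $G$ is bipartite, or the canonical decomposition $(D_G,A_G,C_G)$ of $G$ satisfies all of the following: (i) $C_G=\emptyset$; (ii) $A_G\subseteq I$ for every maximum independent set $I$ of $G$; (iii) every nontrivial connected component of $G[D_G]$ is good.
   Context: All graphs are finite, undirected and loopless. $\alpha(G)$ is the independence number (size of a largest independent set) and $\mu(G)$ is the matching number (size of a largest matching) of $G$. For $S\subseteq V(G)$, $G[S]$ is the induced subgraph, and for disjoint $S,T\subseteq V(G)$, $E_G(S,T)$ is the set of edges joining $S$ to $T$. A component is nontrivial if it has at least one edge. Canonical (Gallai–Edmonds) decomposition: $D_G$ is the set of vertices of $G$ that are left unsaturated by at least one maximum matching of $G$; $A_G$ is the set of vertices in $V(G)\setminus D_G$ adjacent to at least one vertex of $D_G$; $C_G=V(G)\setminus(D_G\cup A_G)$. The components of $D_G$ are the connected components of $G[D_G]$. A connected component $D_i$ of $G[D_G]$ is called good if it is nontrivial and (a) $\alpha(D_i)=(|V(D_i)|-1)/2$, and (b) $D_i$ has a maximum independent set $I(D_i)$ (of $D_i$) with $E_G(I(D_i),A_G)=\emptyset$. *)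

theory Defs
  imports Complex_Main
begin

text \<open>
  Finite, undirected, loopless graphs. Parallel edges are allowed: edges are abstract objects,
  and \<open>ends e\<close> is the unordered pair of end vertices of \<open>e\<close>. The simple graphs are those for
  which \<open>ends\<close> is injective on the edges.
\<close>

record ('v, 'e) mgraph =
  verts :: "'v set"
  edges :: "'e set"
  ends :: "'e \<Rightarrow> 'v set"

definition loopless_graph :: "('v, 'e) mgraph \<Rightarrow> bool" where
  "loopless_graph G \<longleftrightarrow> finite (verts G) \<and> finite (edges G) \<and>
     (\<forall>e\<in>edges G. ends G e \<subseteq> verts G \<and> card (ends G e) = 2)"

definition adjacent :: "('v, 'e) mgraph \<Rightarrow> 'v \<Rightarrow> 'v \<Rightarrow> bool" where
  "adjacent G u v \<longleftrightarrow> (\<exists>e\<in>edges G. ends G e = {u, v})"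

definition degree :: "('v, 'e) mgraph \<Rightarrow> 'v \<Rightarrow> nat" where
  "degree G v = card {e \<in> edges G. v \<in> ends G e}"

definition regular :: "nat \<Rightarrow> ('v, 'e) mgraph \<Rightarrow> bool" where
  "regular r G \<longleftrightarrow> (\<forall>v\<in>verts G. degree G v = r)"

definition connected_graph :: "('v, 'e) mgraph \<Rightarrow> bool" where
  "connected_graph G \<longleftrightarrow>
     verts G \<noteq> {} \<and> (\<forall>u\<in>verts G. \<forall>v\<in>verts G. (adjacent G)\<^sup>*\<^sup>* u v)"

definition bipartite :: "('v, 'e) mgraph \<Rightarrow> bool" where
  "bipartite G \<longleftrightarrow> (\<exists>X Y. X \<union> Y = verts G \<and> X \<inter> Y = {} \<and>
     (\<forall>e\<in>edges G. \<exists>x\<in>X. \<exists>y\<in>Y. ends G e = {x, y}))"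

definition induced_subgraph :: "('v, 'e) mgraph \<Rightarrow> 'v set \<Rightarrow> ('v, 'e) mgraph" where
  "induced_subgraph G S =
     \<lparr>verts = verts G \<inter> S, edges = {e \<in> edges G. ends G e \<subseteq> S}, ends = ends G\<rparr>"

definition edges_between :: "('v, 'e) mgraph \<Rightarrow> 'v set \<Rightarrow> 'v set \<Rightarrow> 'e set" where
  "edges_between G S T = {e \<in> edges G. \<exists>s\<in>S. \<exists>t\<in>T. ends G e = {s, t}}"

text \<open>Components are subgraphs: those induced by the reachability classes.\<close>

definition components :: "('v, 'e) mgraph \<Rightarrow> ('v, 'e) mgraph set" where
  "components G =
     (\<lambda>u. induced_subgraph G {v \<in> verts G. (adjacent G)\<^sup>*\<^sup>* u v}) ` verts G"

definition nontrivial :: "('v, 'e) mgraph \<Rightarrow> bool" where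
  "nontrivial H \<longleftrightarrow> edges H \<noteq> {}"

definition independent_set :: "('v, 'e) mgraph \<Rightarrow> 'v set \<Rightarrow> bool" where
  "independent_set G I \<longleftrightarrow> I \<subseteq> verts G \<and> (\<forall>u\<in>I. \<forall>v\<in>I. \<not> adjacent G u v)"

definition independence_number :: "('v, 'e) mgraph \<Rightarrow> nat" where
  "independence_number G = Max (card ` {I. independent_set G I})"

definition maximum_independent_set :: "('v, 'e) mgraph \<Rightarrow> 'v set \<Rightarrow> bool" where
  "maximum_independent_set G I \<longleftrightarrow> independent_set G I \<and> card I = independence_number G"

definition matching :: "('v, 'e) mgraph \<Rightarrow> 'e set \<Rightarrow> bool" where
  "matching G M \<longleftrightarrow>
     M \<subseteq> edges G \<and> (\<forall>e\<in>M. \<forall>f\<in>M. e \<noteq> f \<longrightarrow> ends G e \<inter> ends G f = {})"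

definition matching_number :: "('v, 'e) mgraph \<Rightarrow> nat" where
  "matching_number G = Max (card ` {M. matching G M})"

definition maximum_matching :: "('v, 'e) mgraph \<Rightarrow> 'e set \<Rightarrow> bool" where
  "maximum_matching G M \<longleftrightarrow> matching G M \<and> card M = matching_number G"

definition saturates :: "('v, 'e) mgraph \<Rightarrow> 'e set \<Rightarrow> 'v \<Rightarrow> bool" where
  "saturates G M v \<longleftrightarrow> (\<exists>e\<in>M. v \<in> ends G e)"

text \<open>The canonical (Gallai--Edmonds) decomposition.\<close>

definition D_part :: "('v, 'e) mgraph \<Rightarrow> 'v set" where
  "D_part G = {v \<in> verts G. \<exists>M. maximum_matching G M \<and> \<not> saturates G M v}"

definition A_part :: "('v, 'e) mgraph \<Rightarrow> 'v set" where
  "A_part G = {v \<in> verts G - D_part G. \<exists>u\<in>D_part G. adjacent G v u}"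

definition C_part :: "('v, 'e) mgraph \<Rightarrow> 'v set" where
  "C_part G = verts G - (D_part G \<union> A_part G)"

text \<open>
  Intended for components \<open>H\<close> of the subgraph induced by \<open>D_part G\<close>. The equation for
  \<open>\<alpha>(H)\<close> is stated over the reals, so it forces the order of \<open>H\<close> to be odd.
\<close>

definition good_component :: "('v, 'e) mgraph \<Rightarrow> ('v, 'e) mgraph \<Rightarrow> bool" where
  "good_component G H \<longleftrightarrow> nontrivial H \<and>
     real (independence_number H) = (real (card (verts H)) - 1) / 2 \<and>
     (\<exists>I. maximum_independent_set H I \<and> edges_between G I (A_part G) = {})"

end

theory Submission
  imports Defs
begin

text \<open>
  Every independent set \<open>I\<close> of an \<open>r\<close>-regular graph with \<open>r \<ge> 1\<close> satisfies \<open>|I| \<le> \<mu>(G)\<close>, and the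
  theorem is the analysis of equality. By the Gallai--Edmonds theorem
  \<open>\<mu>(G) = |A| + |C|/2 + \<Sum> (|D\<^sub>i| - 1)/2\<close>, while \<open>I\<close> contains at most half of \<open>C\<close> and, by
  factor-criticality, at most \<open>(|D\<^sub>i| - 1)/2\<close> vertices of a nontrivial component \<open>D\<^sub>i\<close>. The
  trivial components lying in \<open>I\<close> have all their neighbours in \<open>A - I\<close>, so by regularity there are
  at most \<open>|A - I|\<close> of them. In case of equality, no edge leaves the union of these trivial
  components with \<open>A - I\<close>, and by connectedness either this union is empty or \<open>G\<close> is bipartite.
  Once \<open>A \<subseteq> I\<close>, the same count applied to \<open>C \<inter> I\<close> and \<open>C - I\<close> shows that \<open>C\<close> is empty.
\<close>

section \<open>Matchings\<close>

definition covered :: "('v, 'e) mgraph \<Rightarrow> 'e set \<Rightarrow> 'v set" where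
  "covered G M = (\<Union>e\<in>M. ends G e)"

lemma saturates_iff_covered: "saturates G M v \<longleftrightarrow> v \<in> covered G M"
  by (auto simp: saturates_def covered_def)

lemma adjacent_sym: "adjacent G u v \<Longrightarrow> adjacent G v u"
  by (auto simp: adjacent_def insert_commute)

lemma edge_endsE:
  assumes "loopless_graph G" "e \<in> edges G" "x \<in> ends G e"
  obtains y where "ends G e = {x, y}" "x \<noteq> y" "x \<in> verts G" "y \<in> verts G"
proof -
  have c: "card (ends G e) = 2" "ends G e \<subseteq> verts G"
    using assms by (auto simp: loopless_graph_def)
  then obtain a b where "ends G e = {a, b}" "a \<noteq> b" by (auto simp: card_2_iff)
  with c assms(3) that show thesis by (auto simp: insert_commute)
qed

lemma edge_pairE:
  assumes "loopless_graph G" "e \<in> edges G"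
  obtains x y where "ends G e = {x, y}"
proof -
  have "card (ends G e) = 2" using assms by (simp add: loopless_graph_def)
  then show thesis using that unfolding card_2_iff by blast
qed

lemma adjacentD:
  assumes "loopless_graph G" "adjacent G u v"
  shows "u \<noteq> v" "u \<in> verts G" "v \<in> verts G"
proof -
  from assms(2) obtain e where e: "e \<in> edges G" "ends G e = {u, v}"
    by (auto simp: adjacent_def)
  with assms(1) have "card {u, v} = 2" "{u, v} \<subseteq> verts G"
    unfolding loopless_graph_def by metis+
  then show "u \<noteq> v" "u \<in> verts G" "v \<in> verts G" by auto
qed

lemma finite_matching: "loopless_graph G \<Longrightarrow> matching G M \<Longrightarrow> finite M"
  by (auto simp: loopless_graph_def matching_def intro: finite_subset)

lemma finite_matchings: "loopless_graph G \<Longrightarrow> finite {M. matching G M}"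
  by (rule finite_subset[of _ "Pow (edges G)"]) (auto simp: loopless_graph_def matching_def)

lemma card_matching_le: "loopless_graph G \<Longrightarrow> matching G M \<Longrightarrow> card M \<le> matching_number G"
  unfolding matching_number_def using finite_matchings by (intro Max_ge) auto

lemma maximum_matching_exists:
  assumes "loopless_graph G"
  obtains M where "maximum_matching G M"
proof -
  have "matching G {}" by (simp add: matching_def)
  then have "Max (card ` {M. matching G M}) \<in> card ` {M. matching G M}"
    using finite_matchings[OF assms] by (intro Max_in) auto
  then show thesis using that by (auto simp: maximum_matching_def matching_number_def)
qed

lemma matching_subset: "matching G M \<Longrightarrow> N \<subseteq> M \<Longrightarrow> matching G N"
  unfolding matching_def by blast

lemma matching_unique:
  "matching G M \<Longrightarrow> e \<in> M \<Longrightarrow> f \<in> M \<Longrightarrow> x \<in> ends G e \<Longrightarrow> x \<in> ends G f \<Longrightarrow> e = f"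
  unfolding matching_def by blast

lemma covered_subset_verts: "loopless_graph G \<Longrightarrow> matching G M \<Longrightarrow> covered G M \<subseteq> verts G"
  by (fastforce simp: loopless_graph_def matching_def covered_def)

lemma finite_covered: "loopless_graph G \<Longrightarrow> matching G M \<Longrightarrow> finite (covered G M)"
  using covered_subset_verts finite_subset loopless_graph_def by metis

lemma card_covered:
  assumes "loopless_graph G" "matching G M"
  shows "card (covered G M) = 2 * card M"
proof -
  have fin: "finite (ends G e)" "card (ends G e) = 2" if "e \<in> M" for e
  proof -
    show "card (ends G e) = 2" using assms that by (auto simp: loopless_graph_def matching_def)
    then show "finite (ends G e)" by (metis card.infinite zero_neq_numeral)
  qed
  have "card (covered G M) = (\<Sum>e\<in>M. card (ends G e))"
    unfolding covered_def using assms finite_matching[OF assms] fin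
    by (intro card_UN_disjoint) (auto simp: matching_def)
  with fin show ?thesis by simp
qed

lemma matching_insert:
  assumes "loopless_graph G" "matching G M" "e \<in> edges G" "ends G e \<inter> covered G M = {}"
  shows "matching G (insert e M)" "card (insert e M) = Suc (card M)"
proof -
  show "matching G (insert e M)"
    using assms unfolding matching_def covered_def by blast
  have "card (ends G e) = 2" using assms by (auto simp: loopless_graph_def)
  then have "ends G e \<noteq> {}" by auto
  then have "e \<notin> M" using assms(4) by (auto simp: covered_def)
  then show "card (insert e M) = Suc (card M)"
    using finite_matching[OF assms(1,2)] by simp
qed

lemma covered_insert: "covered G (insert e M) = ends G e \<union> covered G M"
  by (auto simp: covered_def)

lemma covered_remove:
  assumes "matching G M" "f \<in> M"
  shows "covered G (M - {f}) = covered G M - ends G f"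
  using assms by (fastforce simp: matching_def covered_def)

lemma D_partI:
  assumes "loopless_graph G" "matching G M" "matching_number G \<le> card M"
    "v \<in> verts G" "v \<notin> covered G M"
  shows "v \<in> D_part G"
  using assms card_matching_le[OF assms(1,2)]
  by (auto simp: D_part_def maximum_matching_def saturates_iff_covered intro!: exI[of _ M])

lemma D_partE:
  assumes "v \<in> D_part G"
  obtains M where "matching G M" "card M = matching_number G" "v \<notin> covered G M" "v \<in> verts G"
  using assms by (auto simp: D_part_def maximum_matching_def saturates_iff_covered)

text \<open>One step along an alternating path: the edge \<open>f\<close> of \<open>N\<close> at
  \<open>y\<close> is replaced by \<open>e\<close>. Since \<open>x\<close> is uncovered by
  \<open>N\<close>, \<open>f\<close> differs from \<open>e\<close>, the only edge of
  \<open>M\<close> at \<open>y\<close>; hence \<open>f\<close> is not in \<open>M\<close> and the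
  agreement with \<open>M\<close> grows strictly.\<close>

lemma matching_exchange:
  assumes G: "loopless_graph G" and M: "matching G M" and N: "matching G N"
    and e: "e \<in> M" "ends G e = {x, y}" and x: "x \<notin> covered G N" and y: "y \<in> covered G N"
  obtains N' where "matching G N'" "card N' = card N" "covered G N' \<subseteq> insert x (covered G N)"
    "card (M \<inter> N) < card (M \<inter> N')"
proof -
  obtain f where f: "f \<in> N" "y \<in> ends G f" using y by (auto simp: covered_def)
  have fN: "f \<notin> M"
  proof
    assume "f \<in> M"
    with matching_unique[OF M] e f have "f = e" by auto
    with f e x show False by (auto simp: covered_def)
  qed
  have N0: "matching G (N - {f})" using N by (rule matching_subset) auto
  have eG: "e \<in> edges G" using M e by (auto simp: matching_def)
  have dis: "ends G e \<inter> covered G (N - {f}) = {}"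
    using covered_remove[OF N f(1)] e x f by auto
  define N' where "N' = insert e (N - {f})"
  have m: "matching G N'" "card N' = Suc (card (N - {f}))"
    unfolding N'_def using matching_insert[OF G N0 eG dis] by auto
  have fin: "finite N" "finite M" using G M N finite_matching by auto
  have c: "card N' = card N" using m fin f by (metis card.remove)
  have cov: "covered G N' \<subseteq> insert x (covered G N)"
    unfolding N'_def covered_insert using covered_remove[OF N f(1)] e y by auto
  have "e \<notin> N" using e x by (auto simp: covered_def)
  then have "M \<inter> N \<subset> M \<inter> N'" unfolding N'_def using fN e by auto
  then have "card (M \<inter> N) < card (M \<inter> N')" using fin by (simp add: psubset_card_mono)
  with m c cov that show thesis by blast
qed

text \<open>Among the matchings of size \<open>card N\<close> avoiding \<open>Z\<close>, one that shares as many edges as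
  possible with \<open>M\<close> does the job. This replaces all alternating-path arguments.\<close>

lemma matching_exchange_extremal:
  assumes G: "loopless_graph G" and M: "matching G M" and N: "matching G N"
    and Z: "Z \<inter> covered G N = {}"
  obtains N' where "matching G N'" "card N' = card N" "Z \<inter> covered G N' = {}"
    "covered G M \<subseteq> covered G N' \<union> Z \<or>
     (\<exists>e\<in>M. ends G e \<inter> covered G N' = {} \<and> \<not> ends G e \<subseteq> Z)"
proof -
  let ?Q = "\<lambda>N'. matching G N' \<and> card N' = card N \<and> Z \<inter> covered G N' = {}"
  have Q: "?Q N" using N Z by simp
  have bnd: "\<forall>N'. ?Q N' \<longrightarrow> card (M \<inter> N') < Suc (card M)"
    using finite_matching[OF G M] by (auto simp: less_Suc_eq_le intro: card_mono)
  obtain N' where *: "?Q N' \<and> (\<forall>N''. ?Q N'' \<longrightarrow> card (M \<inter> N'') \<le> card (M \<inter> N'))"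
    using ex_has_greatest_nat[where P = ?Q and f = "\<lambda>N'. card (M \<inter> N')", OF Q bnd] by (rule exE)
  note N' = *[THEN conjunct1] and max = *[THEN conjunct2]
  have "\<exists>e\<in>M. ends G e \<inter> covered G N' = {} \<and> \<not> ends G e \<subseteq> Z"
    if sub: "\<not> covered G M \<subseteq> covered G N' \<union> Z"
  proof -
    obtain x where x: "x \<in> covered G M" "x \<notin> covered G N'" "x \<notin> Z" using sub by auto
    then obtain e where e: "e \<in> M" "x \<in> ends G e" by (auto simp: covered_def)
    with M have "e \<in> edges G" by (auto simp: matching_def)
    then obtain y where y: "ends G e = {x, y}" using edge_endsE[OF G _ e(2)] by metis
    \<comment> \<open>Otherwise an exchange along \<open>e\<close> would cover no new vertex except
      \<open>x\<close>, which lies outside \<open>Z\<close>, and would share more edges with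
      \<open>M\<close> than the extremal choice allows.\<close>
    have "y \<notin> covered G N'"
    proof
      assume "y \<in> covered G N'"
      with N' obtain N'' where N'': "matching G N''" "card N'' = card N'"
        "covered G N'' \<subseteq> insert x (covered G N')" "card (M \<inter> N') < card (M \<inter> N'')"
        using matching_exchange[OF G M _ e(1) y x(2)] by metis
      moreover have "?Q N''" using N' N'' x by auto
      ultimately show False using max by (metis leD)
    qed
    with e x y show ?thesis by auto
  qed
  then have "covered G M \<subseteq> covered G N' \<union> Z \<or>
      (\<exists>e\<in>M. ends G e \<inter> covered G N' = {} \<and> \<not> ends G e \<subseteq> Z)" by argo
  with N' show thesis by (elim conjE, intro that)
qed

section \<open>Gallai's lemma\<close>

lemma no_common_exposure_adjacent:
  assumes G: "loopless_graph G" and uv: "adjacent G u v"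
    and M: "matching G M" "card M = matching_number G" and "u \<notin> covered G M"
  shows "v \<in> covered G M"
proof (rule ccontr)
  assume v: "v \<notin> covered G M"
  obtain e where e: "e \<in> edges G" "ends G e = {u, v}" using uv by (auto simp: adjacent_def)
  with assms v have "ends G e \<inter> covered G M = {}" by auto
  from matching_insert[OF G M(1) e(1) this] card_matching_le[OF G] M show False
    by (metis Suc_n_not_le_n)
qed

text \<open>The case \<open>u = v\<close> is deliberately included; it says that a single vertex is
  missed by some maximum matching. The negation of this relation is transitive through vertices of
  D, which is the core of Gallai's lemma.\<close>

definition commonly_exposed :: "('v, 'e) mgraph \<Rightarrow> 'v \<Rightarrow> 'v \<Rightarrow> bool" where
  "commonly_exposed G u v \<longleftrightarrow>
     (\<exists>M. matching G M \<and> card M = matching_number G \<and> u \<notin> covered G M \<and> v \<notin> covered G M)"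

text \<open>If both alternatives fail, the maximum matching \<open>N'\<close> missing
  \<open>t\<close> must cover \<open>u\<close> and \<open>v\<close>, both missed by
  \<open>M\<close>. Either \<open>N'\<close> together with \<open>t\<close> covers everything that
  \<open>M\<close> covers, and then the count is off by one, or an edge of \<open>M\<close> is
  disjoint from \<open>N'\<close> and enlarges a maximum matching.\<close>

lemma commonly_exposed_cotrans:
  assumes G: "loopless_graph G" and t: "t \<in> D_part G"
    and uv: "commonly_exposed G u v" "u \<noteq> v"
  shows "commonly_exposed G u t \<or> commonly_exposed G t v"
proof (rule ccontr)
  assume no: "\<not> (commonly_exposed G u t \<or> commonly_exposed G t v)"
  obtain M where M: "matching G M" "card M = matching_number G" "u \<notin> covered G M" "v \<notin> covered G M"
    using uv by (auto simp: commonly_exposed_def)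
  obtain N where N: "matching G N" "card N = matching_number G" "t \<notin> covered G N"
    using t by (auto elim: D_partE)
  then have "{t} \<inter> covered G N = {}" by simp
  then obtain N' where N': "matching G N'" "card N' = card N" "{t} \<inter> covered G N' = {}"
    and alt: "covered G M \<subseteq> covered G N' \<union> {t} \<or>
     (\<exists>e\<in>M. ends G e \<inter> covered G N' = {} \<and> \<not> ends G e \<subseteq> {t})"
    by (rule matching_exchange_extremal[OF G M(1) N(1)])
  from N' N have N': "matching G N'" "card N' = matching_number G" "t \<notin> covered G N'" by auto
  from alt show False
  proof
    assume sub: "covered G M \<subseteq> covered G N' \<union> {t}"
    have "u \<in> covered G N'" "v \<in> covered G N'"
      using no N' by (auto simp: commonly_exposed_def)
    then have "insert u (insert v (covered G M)) \<subseteq> insert t (covered G N')" using sub by auto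
    then have "card (insert u (insert v (covered G M))) \<le> card (insert t (covered G N'))"
      using finite_covered[OF G N'(1)] by (intro card_mono) auto
    then show False
      using M N' uv finite_covered[OF G M(1)] finite_covered[OF G N'(1)]
        card_covered[OF G M(1)] card_covered[OF G N'(1)] by simp
  next
    assume "\<exists>e\<in>M. ends G e \<inter> covered G N' = {} \<and> \<not> ends G e \<subseteq> {t}"
    then obtain e where e: "e \<in> edges G" "ends G e \<inter> covered G N' = {}"
      using M by (auto simp: matching_def)
    from matching_insert[OF G N'(1) e] card_matching_le[OF G] N' show False
      by (metis Suc_n_not_le_n)
  qed
qed

lemma adjacent_induced_iff:
  "adjacent (induced_subgraph G S) u v \<longleftrightarrow> adjacent G u v \<and> u \<in> S \<and> v \<in> S"
  by (auto simp: adjacent_def induced_subgraph_def)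

text \<open>Induction along a path inside D. Its last edge joins \<open>t\<close> to
  \<open>v\<close>, and adjacent vertices are never commonly exposed. If \<open>u\<close> and
  \<open>v\<close> differ, cotransitivity therefore moves the exposure to \<open>u\<close> and
  \<open>t\<close>, so \<open>u = t\<close> by induction, and then \<open>u\<close> and
  \<open>v\<close> are adjacent after all.\<close>

lemma gallai:
  assumes G: "loopless_graph G"
    and reach: "(adjacent (induced_subgraph G (D_part G)))\<^sup>*\<^sup>* u v"
    and "commonly_exposed G u v"
  shows "u = v"
  using reach assms(3)
proof (induction rule: rtranclp_induct)
  case base
  then show ?case by simp
next
  case (step t v)
  have t: "t \<in> D_part G" "adjacent G t v" using step by (auto simp: adjacent_induced_iff)
  have "\<not> commonly_exposed G t v"
    using no_common_exposure_adjacent[OF G t(2)] by (auto simp: commonly_exposed_def)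
  with commonly_exposed_cotrans[OF G t(1) step.prems] step.IH step.prems show ?case by blast
qed

section \<open>Gallai's stability lemma\<close>

lemma loopless_induced: "loopless_graph G \<Longrightarrow> loopless_graph (induced_subgraph G S)"
  by (auto simp: loopless_graph_def induced_subgraph_def)

lemma covered_induced [simp]: "covered (induced_subgraph G S) M = covered G M"
  by (simp add: covered_def induced_subgraph_def)

lemma verts_induced [simp]: "verts (induced_subgraph G S) = verts G \<inter> S"
  by (simp add: induced_subgraph_def)

lemma matching_induced_iff:
  "matching (induced_subgraph G S) M \<longleftrightarrow> matching G M \<and> covered G M \<subseteq> S"
  by (auto simp: matching_def induced_subgraph_def covered_def)

lemma induced_induced:
  "S \<subseteq> T \<Longrightarrow> induced_subgraph (induced_subgraph G T) S = induced_subgraph G S"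
  by (auto simp: induced_subgraph_def)

lemma D_part_subset: "D_part G \<subseteq> verts G"
  by (auto simp: D_part_def)

lemma covered_if_not_D_part:
  assumes "loopless_graph G" "a \<in> verts G" "a \<notin> D_part G" "matching G M" "card M = matching_number G"
  shows "a \<in> covered G M"
  using assms D_partI by fastforce

text \<open>Every maximum matching covers \<open>a\<close>, so removing its edge at \<open>a\<close>
  costs exactly one; a matching of full size avoiding \<open>a\<close> would put \<open>a\<close>
  into D.\<close>

lemma matching_number_delete:
  assumes G: "loopless_graph G" and a: "a \<in> verts G" "a \<notin> D_part G"
  shows "Suc (matching_number (induced_subgraph G (verts G - {a}))) = matching_number G"
    (is "Suc (matching_number ?H) = _")
proof -
  obtain M where M: "matching G M" "card M = matching_number G"
    using maximum_matching_exists[OF G] by (auto simp: maximum_matching_def)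
  then obtain e where e: "e \<in> M" "a \<in> ends G e"
    using covered_if_not_D_part[OF G a] by (auto simp: covered_def)
  have "matching ?H (M - {e})"
    using matching_subset[OF M(1)] covered_remove[OF M(1) e(1)] e covered_subset_verts[OF G M(1)]
    by (auto simp: matching_induced_iff)
  then have "card (M - {e}) \<le> matching_number ?H"
    using card_matching_le[OF loopless_induced[OF G]] by blast
  moreover have "Suc (card (M - {e})) = card M"
    using e finite_matching[OF G M(1)] by (metis card.remove)
  moreover have "matching_number ?H < matching_number G"
  proof -
    obtain N where N: "matching ?H N" "card N = matching_number ?H"
      using maximum_matching_exists[OF loopless_induced[OF G]]
      unfolding maximum_matching_def by metis
    then have "a \<notin> covered G N" "matching G N" by (auto simp: matching_induced_iff)
    with a N show ?thesis using D_partI[OF G] by force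
  qed
  ultimately show ?thesis using M by simp
qed

text \<open>This is the stability lemma. One inclusion drops the edge at \<open>a\<close> from a
  maximum matching missing \<open>v\<close>. For the other, a maximum matching of the smaller graph
  that misses some \<open>v\<close> outside D is compared with a maximum matching of
  \<open>G\<close> that misses a neighbour \<open>d\<close> of \<open>a\<close> in D.\<close>

lemma D_part_delete:
  assumes G: "loopless_graph G" and a: "a \<in> A_part G"
  shows "D_part (induced_subgraph G (verts G - {a})) = D_part G" (is "D_part ?H = _")
proof
  have aV: "a \<in> verts G" "a \<notin> D_part G" using a by (auto simp: A_part_def)
  note mu = matching_number_delete[OF G aV]
  note H = loopless_induced[OF G, of "verts G - {a}"]
  show "D_part G \<subseteq> D_part ?H"
  proof
    fix v assume v: "v \<in> D_part G"
    then obtain M where M: "matching G M" "card M = matching_number G" "v \<notin> covered G M" "v \<in> verts G"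
      by (rule D_partE)
    obtain e where e: "e \<in> M" "a \<in> ends G e"
      using covered_if_not_D_part[OF G aV M(1,2)] by (auto simp: covered_def)
    have "matching ?H (M - {e})"
      using matching_subset[OF M(1)] covered_remove[OF M(1) e(1)] e covered_subset_verts[OF G M(1)]
      by (auto simp: matching_induced_iff)
    moreover have "Suc (card (M - {e})) = card M"
      using e finite_matching[OF G M(1)] by (metis card.remove)
    moreover have "v \<notin> covered G (M - {e})" using M by (auto simp: covered_def)
    moreover have "v \<noteq> a" using v aV by auto
    ultimately show "v \<in> D_part ?H" using mu M by (intro D_partI[OF H, of "M - {e}"]) auto
  qed
  show "D_part ?H \<subseteq> D_part G"
  proof (rule subsetI, rule ccontr)
    fix v assume "v \<in> D_part ?H" and v: "v \<notin> D_part G"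
    then obtain N where N0: "matching ?H N" "card N = matching_number ?H" "v \<notin> covered ?H N" "v \<in> verts ?H"
      by (elim D_partE)
    then have N: "matching G N" "{a, v} \<inter> covered G N = {}" and vV: "v \<in> verts G" "v \<noteq> a"
      by (auto simp: matching_induced_iff)
    obtain d where d: "d \<in> D_part G" "adjacent G a d" using a by (auto simp: A_part_def)
    then obtain M where M: "matching G M" "card M = matching_number G" "d \<notin> covered G M"
      by (auto elim: D_partE)
    have cov: "w \<in> covered G L" if "w \<in> {a, v}" "matching G L" "card L = matching_number G" for w L
      using that covered_if_not_D_part[OF G] aV v vV by auto
    obtain N' where N': "matching G N'" "card N' = matching_number ?H" "{a, v} \<inter> covered G N' = {}"
      and alt: "covered G M \<subseteq> covered G N' \<union> {a, v} \<or>
       (\<exists>e\<in>M. ends G e \<inter> covered G N' = {} \<and> \<not> ends G e \<subseteq> {a, v})"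
      using matching_exchange_extremal[OF G M(1) N] N0(2) by metis
    \<comment> \<open>Adding such an edge to \<open>N'\<close> gives a maximum matching of
      \<open>G\<close>. It must cover \<open>a\<close> and \<open>v\<close>, as neither is in D,
      while \<open>N'\<close> covers neither.\<close>
    have aug: "{a, v} \<subseteq> ends G e" if "e \<in> edges G" "ends G e \<inter> covered G N' = {}" for e
    proof -
      have "{a, v} \<subseteq> covered G (insert e N')"
        using cov matching_insert[OF G N'(1) that] N'(2) mu by auto
      with N'(3) show ?thesis by (auto simp: covered_insert)
    qed
    from alt show False
    proof
      assume sub: "covered G M \<subseteq> covered G N' \<union> {a, v}"
      \<comment> \<open>Otherwise \<open>M\<close> and \<open>d\<close> would account for 2\<mu> + 1
        vertices among the at most 2(\<mu> - 1) + 2 vertices covered by \<open>N'\<close> or equal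
        to \<open>a\<close> or \<open>v\<close>. With \<open>d\<close> free, the edge from
        \<open>a\<close> to \<open>d\<close> can be added to \<open>N'\<close>, yet it avoids
        \<open>v\<close>, against \<open>aug\<close>.\<close>
      have "d \<notin> covered G N'"
      proof
        assume "d \<in> covered G N'"
        then have "insert d (covered G M) \<subseteq> insert a (insert v (covered G N'))" using sub by auto
        then have "card (insert d (covered G M)) \<le> card (insert a (insert v (covered G N')))"
          using finite_covered[OF G N'(1)] by (intro card_mono) auto
        also have "\<dots> \<le> Suc (Suc (card (covered G N')))"
          using finite_covered[OF G N'(1)] by (simp add: card_insert_if)
        finally show False
          using M(2,3) N'(2) mu finite_covered[OF G M(1)]
            card_covered[OF G M(1)] card_covered[OF G N'(1)] by simp
      qed
      moreover obtain e where "e \<in> edges G" "ends G e = {a, d}"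
        using d by (auto simp: adjacent_def)
      moreover have "d \<noteq> v" using d v by auto
      ultimately show False using aug[of e] N'(3) vV(2) by auto
    next
      assume "\<exists>e\<in>M. ends G e \<inter> covered G N' = {} \<and> \<not> ends G e \<subseteq> {a, v}"
      then obtain e where e: "e \<in> edges G" "ends G e \<inter> covered G N' = {}" "\<not> ends G e \<subseteq> {a, v}"
        using M by (auto simp: matching_def)
      obtain y where "ends G e = {a, y}" using edge_endsE[OF G e(1), of a] aug[OF e(1,2)] by auto
      with aug[OF e(1,2)] e(3) vV show False by auto
    qed
  qed
qed

lemma A_part_delete:
  assumes G: "loopless_graph G" and a: "a \<in> A_part G"
  shows "A_part (induced_subgraph G (verts G - {a})) = A_part G - {a}"
proof -
  have "a \<notin> D_part G" using a by (auto simp: A_part_def)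
  then show ?thesis
    using D_part_subset[of G] unfolding A_part_def D_part_delete[OF assms]
    by (auto simp: adjacent_induced_iff)
qed

text \<open>The vertices of A are removed one by one. By stability, D and the rest of A survive each
  removal, and the matching number drops by one each time. In the remaining graph no edge leaves
  D.\<close>

lemma delete_A_part:
  assumes "loopless_graph G"
  defines "H \<equiv> induced_subgraph G (verts G - A_part G)"
  shows "D_part H = D_part G" "A_part H = {}" "matching_number H + card (A_part G) = matching_number G"
proof -
  have "D_part (induced_subgraph G (verts G - A_part G)) = D_part G \<and>
      A_part (induced_subgraph G (verts G - A_part G)) = {} \<and>
      matching_number (induced_subgraph G (verts G - A_part G)) + card (A_part G) = matching_number G"
    using assms(1)
  proof (induction "card (A_part G)" arbitrary: G)
    case 0
    then have "finite (A_part G)" by (auto simp: A_part_def loopless_graph_def)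
    with 0 have A: "A_part G = {}" by simp
    have "induced_subgraph G (verts G) = G"
      using 0 by (cases G) (auto simp: induced_subgraph_def loopless_graph_def)
    with A show ?case by simp
  next
    case (Suc n)
    then obtain a where a: "a \<in> A_part G" by fastforce
    let ?H = "induced_subgraph G (verts G - {a})"
    have aV: "a \<in> verts G" "a \<notin> D_part G" using a by (auto simp: A_part_def)
    have fin: "finite (A_part G)" using Suc by (auto simp: A_part_def loopless_graph_def)
    note AH = A_part_delete[OF Suc.prems a]
    have n: "n = card (A_part ?H)" using Suc(2) AH a fin by simp
    have "verts ?H - A_part ?H = verts G - A_part G" using AH a by auto
    moreover have "induced_subgraph ?H (verts G - A_part G) = induced_subgraph G (verts G - A_part G)"
      by (rule induced_induced) (use a in auto)
    ultimately have "induced_subgraph ?H (verts ?H - A_part ?H) = induced_subgraph G (verts G - A_part G)"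
      by simp
    with Suc.hyps(1)[OF n loopless_induced[OF Suc.prems]] matching_number_delete[OF Suc.prems aV]
      D_part_delete[OF Suc.prems a] n Suc(2)
    show ?case by simp
  qed
  then show "D_part H = D_part G" "A_part H = {}"
    "matching_number H + card (A_part G) = matching_number G"
    unfolding H_def by blast+
qed


section \<open>Components of the Gallai part\<close>

text \<open>The edges of \<open>M\<close> meeting \<open>W\<close> form a perfect matching of
  \<open>W\<close>, and each contains at most one vertex of \<open>I\<close>.\<close>

lemma independent_in_matched:
  assumes G: "loopless_graph G" and M: "matching G M" and W: "W \<subseteq> covered G M"
    and closed: "\<And>e. e \<in> M \<Longrightarrow> ends G e \<inter> W \<noteq> {} \<Longrightarrow> ends G e \<subseteq> W"
  shows "even (card W)" "independent_set G I \<Longrightarrow> 2 * card (I \<inter> W) \<le> card W"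
proof -
  define L where "L = {e \<in> M. ends G e \<inter> W \<noteq> {}}"
  have L: "matching G L" using M by (rule matching_subset) (auto simp: L_def)
  have cov: "covered G L = W"
  proof
    show "covered G L \<subseteq> W" using closed by (auto simp: L_def covered_def)
    show "W \<subseteq> covered G L"
    proof
      fix v assume v: "v \<in> W"
      then obtain e where e: "e \<in> M" "v \<in> ends G e" using W by (auto simp: covered_def)
      with v have "e \<in> L" by (auto simp: L_def)
      with e show "v \<in> covered G L" by (auto simp: covered_def)
    qed
  qed
  have card: "card W = 2 * card L" using card_covered[OF G L] cov by simp
  then show "even (card W)" by simp
  assume I: "independent_set G I"
  have one: "card (I \<inter> ends G e) \<le> 1" if "e \<in> L" for e
  proof -
    have e: "e \<in> edges G" using that L by (auto simp: matching_def)
    then obtain x y where xy: "ends G e = {x, y}" by (rule edge_pairE[OF G])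
    then have "\<not> (x \<in> I \<and> y \<in> I)"
      using e I by (auto simp: independent_set_def adjacent_def)
    then have "I \<inter> ends G e \<subseteq> {x} \<or> I \<inter> ends G e \<subseteq> {y}" using xy by auto
    then show ?thesis
    proof
      assume "I \<inter> ends G e \<subseteq> {x}"
      from card_mono[OF _ this] show ?thesis by simp
    next
      assume "I \<inter> ends G e \<subseteq> {y}"
      from card_mono[OF _ this] show ?thesis by simp
    qed
  qed
  have "I \<inter> W = (\<Union>e\<in>L. I \<inter> ends G e)" using cov by (auto simp: covered_def)
  then have "card (I \<inter> W) \<le> (\<Sum>e\<in>L. card (I \<inter> ends G e))"
    by (simp only: card_UN_le[OF finite_matching[OF G L]])
  also have "\<dots> \<le> (\<Sum>e\<in>L. 1)" using one by (rule sum_mono)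
  finally show "2 * card (I \<inter> W) \<le> card W" using card by simp
qed

section \<open>Components of G[D] as a partition of D into vertex sets\<close>

definition D_classes :: "('v, 'e) mgraph \<Rightarrow> 'v set set" where
  "D_classes G = (\<lambda>u. {v \<in> D_part G. (adjacent (induced_subgraph G (D_part G)))\<^sup>*\<^sup>* u v}) ` D_part G"

lemma components_D_part:
  "components (induced_subgraph G (D_part G)) = induced_subgraph G ` D_classes G"
proof -
  have "verts G \<inter> D_part G = D_part G" using D_part_subset[of G] by auto
  then show ?thesis
    unfolding components_def D_classes_def image_image verts_induced
    by (intro image_cong) (auto intro!: induced_induced)
qed

lemma reach_sym: "(adjacent G)\<^sup>*\<^sup>* u v \<Longrightarrow> (adjacent G)\<^sup>*\<^sup>* v u"
  by (rule sympD[OF symp_rtranclp]) (rule sympI, erule adjacent_sym)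

lemma Union_D_classes: "\<Union> (D_classes G) = D_part G"
  by (auto simp: D_classes_def)

lemma D_class_subset: "S \<in> D_classes G \<Longrightarrow> S \<subseteq> D_part G"
  by (auto simp: D_classes_def)

lemma D_class_nonempty: "S \<in> D_classes G \<Longrightarrow> S \<noteq> {}"
  by (auto simp: D_classes_def)

lemma D_class_eq:
  assumes "S \<in> D_classes G" "u \<in> S"
  shows "S = {v \<in> D_part G. (adjacent (induced_subgraph G (D_part G)))\<^sup>*\<^sup>* u v}"
proof -
  let ?R = "(adjacent (induced_subgraph G (D_part G)))\<^sup>*\<^sup>*"
  obtain w where S: "S = {v \<in> D_part G. ?R w v}" using assms(1) by (auto simp: D_classes_def)
  then have "?R w u" using assms(2) by simp
  moreover from this have "?R u w" by (rule reach_sym)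
  ultimately have "?R w v \<longleftrightarrow> ?R u v" for v by (blast intro: rtranclp_trans)
  with S show ?thesis by simp
qed

lemma D_classes_disjoint:
  assumes "S \<in> D_classes G" "S' \<in> D_classes G" "S \<noteq> S'"
  shows "S \<inter> S' = {}"
proof (rule ccontr)
  assume "S \<inter> S' \<noteq> {}"
  then obtain u where u: "u \<in> S" "u \<in> S'" by auto
  from D_class_eq[OF assms(1) u(1)] D_class_eq[OF assms(2) u(2)] assms(3) show False by simp
qed

lemma D_class_closed:
  assumes "S \<in> D_classes G" "u \<in> S" "v \<in> D_part G" "adjacent G u v"
  shows "v \<in> S"
  using assms D_class_eq[OF assms(1,2)] D_class_subset[OF assms(1)]
  by (auto simp: adjacent_induced_iff)

lemma finite_D_part: "loopless_graph G \<Longrightarrow> finite (D_part G)"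
  unfolding loopless_graph_def by (elim conjE, rule finite_subset[OF D_part_subset])

lemma finite_D_classes: "loopless_graph G \<Longrightarrow> finite (D_classes G)"
  unfolding D_classes_def by (intro finite_imageI finite_D_part)

lemma sum_card_D_classes:
  assumes G: "loopless_graph G"
  shows "(\<Sum>S\<in>D_classes G. card (X \<inter> S)) = card (X \<inter> D_part G)"
proof -
  have "card (\<Union>S\<in>D_classes G. X \<inter> S) = (\<Sum>S\<in>D_classes G. card (X \<inter> S))"
    using finite_D_classes[OF G] finite_subset[OF D_class_subset finite_D_part[OF G]]
      D_classes_disjoint[of _ G]
    by (intro card_UN_disjoint ballI impI) (simp, simp, blast)
  moreover have "(\<Union>S\<in>D_classes G. X \<inter> S) = X \<inter> D_part G"
    using Union_D_classes[of G] by auto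
  ultimately show ?thesis by simp
qed

lemma nontrivial_induced_iff:
  assumes "loopless_graph G"
  shows "nontrivial (induced_subgraph G S) \<longleftrightarrow> (\<exists>u\<in>S. \<exists>v\<in>S. adjacent G u v)"
proof
  assume "nontrivial (induced_subgraph G S)"
  then obtain e where e: "e \<in> edges G" "ends G e \<subseteq> S"
    by (auto simp: nontrivial_def induced_subgraph_def)
  then obtain u v where "ends G e = {u, v}" using edge_pairE[OF assms] by metis
  with e show "\<exists>u\<in>S. \<exists>v\<in>S. adjacent G u v" by (auto simp: adjacent_def)
qed (auto simp: nontrivial_def induced_subgraph_def adjacent_def)

lemma trivial_D_class:
  assumes G: "loopless_graph G" and S: "S \<in> D_classes G" "\<not> nontrivial (induced_subgraph G S)"
    and u: "u \<in> S"
  shows "S = {u}"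
proof -
  have "v = u" if v: "v \<in> S" for v
  proof (rule ccontr)
    assume "v \<noteq> u"
    have "(adjacent (induced_subgraph G (D_part G)))\<^sup>*\<^sup>* u v"
      using v D_class_eq[OF S(1) u] by auto
    then obtain w where "adjacent (induced_subgraph G (D_part G)) u w"
      using \<open>v \<noteq> u\<close> by (metis converse_rtranclpE)
    then have w: "adjacent G u w" "w \<in> D_part G" by (auto simp: adjacent_induced_iff)
    then have "w \<in> S" using D_class_closed[OF S(1) u] by auto
    with S u w show False by (auto simp: nontrivial_induced_iff[OF G])
  qed
  with u show ?thesis by blast
qed

text \<open>In \<open>G - A\<close>, no edge joins \<open>D\<close> to \<open>C\<close>, and Gallai's lemma applies to each class of \<open>D\<close>.\<close>

lemma maximum_matching_delete_A_part:
  assumes G: "loopless_graph G" and M: "maximum_matching (induced_subgraph G (verts G - A_part G)) M"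
  shows "matching G M" "card M + card (A_part G) = matching_number G"
    "covered G M \<subseteq> verts G - A_part G" "C_part G \<subseteq> covered G M"
    "\<And>e. e \<in> M \<Longrightarrow> ends G e \<inter> C_part G \<noteq> {} \<Longrightarrow> ends G e \<subseteq> C_part G"
    "\<And>e S. e \<in> M \<Longrightarrow> S \<in> D_classes G \<Longrightarrow> ends G e \<inter> S \<noteq> {} \<Longrightarrow> ends G e \<subseteq> S"
    "\<And>S u v. S \<in> D_classes G \<Longrightarrow> u \<in> S \<Longrightarrow> v \<in> S \<Longrightarrow> u \<notin> covered G M \<Longrightarrow> v \<notin> covered G M \<Longrightarrow> u = v"
proof -
  let ?H = "induced_subgraph G (verts G - A_part G)"
  note H = delete_A_part[OF G] loopless_induced[OF G, of "verts G - A_part G"]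
  have MH: "matching ?H M" "card M = matching_number ?H" using M by (auto simp: maximum_matching_def)
  then show MG: "matching G M" and cov: "covered G M \<subseteq> verts G - A_part G"
    by (auto simp: matching_induced_iff)
  show "card M + card (A_part G) = matching_number G" using H(3) MH by simp
  show C: "C_part G \<subseteq> covered G M"
  proof
    fix v assume "v \<in> C_part G"
    then have "v \<in> verts ?H" "v \<notin> D_part ?H" using H by (auto simp: C_part_def)
    from covered_if_not_D_part[OF H(4) this MH] show "v \<in> covered G M" by simp
  qed
  \<comment> \<open>An edge of \<open>M\<close> avoids A, and a vertex outside D with a neighbour in
    D would belong to A. So no edge of \<open>M\<close> joins D to C.\<close>
  have edge: "\<exists>x y. ends G e = {x, y} \<and> adjacent G x y \<and>
      x \<in> verts G - A_part G \<and> y \<in> verts G - A_part G \<and> (x \<in> D_part G \<longleftrightarrow> y \<in> D_part G)" if e: "e \<in> M" for e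
  proof -
    have eG: "e \<in> edges G" using e MG by (auto simp: matching_def)
    then obtain x y where xy: "ends G e = {x, y}" by (rule edge_pairE[OF G])
    have V: "x \<in> verts G - A_part G" "y \<in> verts G - A_part G"
      using cov e xy by (auto simp: covered_def)
    have adj: "adjacent G x y" using eG xy by (auto simp: adjacent_def)
    with V have "x \<in> D_part G \<longleftrightarrow> y \<in> D_part G"
      using adjacent_sym[OF adj] by (auto simp: A_part_def)
    with V adj xy show ?thesis by blast
  qed
  show "ends G e \<subseteq> C_part G" if "e \<in> M" "ends G e \<inter> C_part G \<noteq> {}" for e
    using edge[OF that(1)] that(2) by (auto simp: C_part_def)
  show "ends G e \<subseteq> S" if e: "e \<in> M" and "S \<in> D_classes G" "ends G e \<inter> S \<noteq> {}" for e S
  proof -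
    obtain x y where xy: "ends G e = {x, y}" "adjacent G x y" "x \<in> D_part G \<longleftrightarrow> y \<in> D_part G"
      using edge[OF e] by blast
    with that D_class_subset[OF that(2)] have "x \<in> D_part G" "y \<in> D_part G" by auto
    with xy that D_class_closed[OF that(2)] adjacent_sym[OF xy(2)] show ?thesis by auto
  qed
  \<comment> \<open>D is disjoint from A, so the deletion of A leaves the components of G[D]
    unchanged, and reachability in a class of \<open>G\<close> is reachability in the graph without
    A.\<close>
  have HD: "induced_subgraph ?H (D_part ?H) = induced_subgraph G (D_part G)"
    unfolding H(1) by (rule induced_induced) (use D_part_subset[of G] in \<open>auto simp: A_part_def\<close>)
  show "u = v" if "S \<in> D_classes G" "u \<in> S" "v \<in> S" "u \<notin> covered G M" "v \<notin> covered G M" for S u v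
  proof (rule gallai[OF H(4)])
    show "(adjacent (induced_subgraph ?H (D_part ?H)))\<^sup>*\<^sup>* u v"
      unfolding HD using D_class_eq[OF that(1,2)] that(3) by auto
    show "commonly_exposed ?H u v" using MH that by (auto simp: commonly_exposed_def)
  qed
qed

text \<open>This is factor-criticality. Since \<open>v\<close> stays in D after the deletion of A,
  some maximum matching there misses \<open>v\<close>. By Gallai's lemma it misses no other vertex
  of \<open>S\<close>, so it matches the rest of \<open>S\<close> perfectly within itself.\<close>

lemma D_class_odd_and_independent:
  assumes G: "loopless_graph G" and S: "S \<in> D_classes G" and v: "v \<in> S"
  shows "odd (card S)" "independent_set G I \<Longrightarrow> 2 * card (I \<inter> (S - {v})) + 1 \<le> card S"
proof -
  let ?H = "induced_subgraph G (verts G - A_part G)"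
  have "v \<in> D_part ?H" using D_class_subset[OF S] v delete_A_part(1)[OF G] by auto
  then obtain M where M: "maximum_matching ?H M" "v \<notin> covered G M"
    by (auto simp: D_part_def saturates_iff_covered)
  note MM = maximum_matching_delete_A_part[OF G M(1)]
  have sub: "S - {v} \<subseteq> covered G M" using MM(7)[OF S v] M(2) by blast
  have cl: "ends G e \<subseteq> S - {v}" if "e \<in> M" "ends G e \<inter> (S - {v}) \<noteq> {}" for e
  proof -
    have "v \<notin> ends G e" using M(2) that(1) by (auto simp: covered_def)
    moreover have "ends G e \<subseteq> S" using MM(6)[OF that(1) S] that(2) by auto
    ultimately show ?thesis by auto
  qed
  have "finite S" using finite_subset[OF D_class_subset[OF S] finite_D_part[OF G]] .
  then have card: "card S = Suc (card (S - {v}))" using v by (metis card.remove)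
  note W = independent_in_matched[OF G MM(1) sub cl]
  show "odd (card S)" using W(1) card by simp
  show "2 * card (I \<inter> (S - {v})) + 1 \<le> card S" if "independent_set G I"
    using W(2)[OF _ _ that] card by simp
qed

text \<open>An edge inside \<open>S\<close> has an end outside \<open>I\<close>; taking that end as
  the vertex \<open>v\<close> left unmatched loses nothing of \<open>I\<close>.\<close>

lemma nontrivial_D_class_independent:
  assumes G: "loopless_graph G" and S: "S \<in> D_classes G" and nt: "nontrivial (induced_subgraph G S)"
    and I: "independent_set G I"
  shows "2 * card (I \<inter> S) + 1 \<le> card S"
proof -
  obtain v where v: "v \<in> S" "v \<notin> I"
    using nt I unfolding nontrivial_induced_iff[OF G] independent_set_def by blast
  then have "I \<inter> (S - {v}) = I \<inter> S" by auto
  with D_class_odd_and_independent(2)[OF G S v(1) I] show ?thesis by simp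
qed

text \<open>The Gallai-Edmonds formula in subtraction-free form. A maximum matching of the graph
  without A covers C and misses exactly one vertex of each class: at most one by Gallai's lemma, at
  least one by parity.\<close>

lemma matching_number_formula:
  assumes G: "loopless_graph G"
  shows "2 * matching_number G + card (D_classes G) =
    2 * card (A_part G) + card (C_part G) + card (D_part G)"
proof -
  obtain M where M: "maximum_matching (induced_subgraph G (verts G - A_part G)) M"
    using maximum_matching_exists[OF loopless_induced[OF G]] by metis
  note MM = maximum_matching_delete_A_part[OF G M]
  define U where "U = D_part G - covered G M"
  have one: "card (U \<inter> S) = 1" if S: "S \<in> D_classes G" for S
  proof -
    have "\<not> S \<subseteq> covered G M"
    proof
      assume "S \<subseteq> covered G M"
      from independent_in_matched(1)[OF G MM(1) this MM(6)[OF _ S]]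
      have "even (card S)" by auto
      moreover obtain v where "v \<in> S" using D_class_nonempty[OF S] by auto
      ultimately show False using D_class_odd_and_independent(1)[OF G S] by simp
    qed
    then obtain u where u: "u \<in> S" "u \<notin> covered G M" by auto
    then have "U \<inter> S = {u}" using MM(7)[OF S u(1) _ u(2)] D_class_subset[OF S] unfolding U_def by blast
    then show ?thesis by simp
  qed
  have "card (U \<inter> D_part G) = (\<Sum>S\<in>D_classes G. 1)"
    unfolding sum_card_D_classes[OF G, symmetric] using one by (intro sum.cong) auto
  moreover have "U \<inter> D_part G = U" by (auto simp: U_def)
  ultimately have U: "card U = card (D_classes G)" by simp
  have fin: "finite (verts G)" using G by (simp add: loopless_graph_def)
  have DA: "D_part G \<inter> A_part G = {}" by (auto simp: A_part_def)
  have eq: "covered G M \<union> U = C_part G \<union> D_part G"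
    using MM(3,4) DA D_part_subset[of G] by (auto simp: U_def C_part_def)
  have "card (covered G M \<union> U) = card (covered G M) + card U"
    using finite_covered[OF G MM(1)] finite_D_part[OF G] by (intro card_Un_disjoint) (auto simp: U_def)
  moreover have "card (C_part G \<union> D_part G) = card (C_part G) + card (D_part G)"
    using fin finite_D_part[OF G] by (intro card_Un_disjoint) (auto simp: C_part_def)
  ultimately have "2 * card M + card (D_classes G) = card (C_part G) + card (D_part G)"
    using eq U card_covered[OF G MM(1)] by simp
  with MM(2) show ?thesis by linarith
qed

section \<open>Regular graphs\<close>

text \<open>Double counting of edges. \<open>X\<close> spans no edge, so exactly
  \<open>card X * r\<close> edges meet \<open>X\<close>. All of them also meet \<open>Y\<close>,
  which is met by at most \<open>card Y * r\<close> edges. Equality forces every edge at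
  \<open>Y\<close> to meet \<open>X\<close>.\<close>

lemma regular_neighbourhood:
  assumes G: "loopless_graph G" and r: "regular r G" "r \<ge> 1" and XY: "X \<subseteq> verts G" "Y \<subseteq> verts G" "X \<inter> Y = {}"
    and nb: "\<And>u v. u \<in> X \<Longrightarrow> adjacent G u v \<Longrightarrow> v \<in> Y"
  shows "card X \<le> card Y" "card X = card Y \<Longrightarrow> v \<in> Y \<Longrightarrow> adjacent G v u \<Longrightarrow> u \<in> X"
proof -
  define E where "E = (\<lambda>S. \<Union>v\<in>S. {e \<in> edges G. v \<in> ends G e})"
  have fin: "finite X" "finite Y" "finite (edges G)"
    using G XY by (auto simp: loopless_graph_def intro: finite_subset)
  have disj: "{e \<in> edges G. u \<in> ends G e} \<inter> {e \<in> edges G. v \<in> ends G e} = {}"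
    if uv: "u \<in> X" "v \<in> X" "u \<noteq> v" for u v
  proof -
    have False if e: "e \<in> edges G" "u \<in> ends G e" "v \<in> ends G e" for e
    proof -
      obtain w where "ends G e = {u, w}" using edge_endsE[OF G e(1,2)] by metis
      with e uv have "ends G e = {u, v}" by auto
      with e uv nb XY(3) show False by (auto simp: adjacent_def)
    qed
    then show ?thesis by auto
  qed
  have deg: "card {e \<in> edges G. v \<in> ends G e} = r" if "v \<in> X \<union> Y" for v
    using r(1) XY that by (auto simp: regular_def degree_def)
  have "card (E X) = (\<Sum>v\<in>X. card {e \<in> edges G. v \<in> ends G e})"
    unfolding E_def using fin disj by (intro card_UN_disjoint) auto
  then have cX: "card (E X) = card X * r" using deg by simp
  have "card (E Y) \<le> (\<Sum>v\<in>Y. card {e \<in> edges G. v \<in> ends G e})"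
    unfolding E_def using fin by (intro card_UN_le)
  then have cY: "card (E Y) \<le> card Y * r" using deg by simp
  have sub: "E X \<subseteq> E Y"
  proof
    fix e assume "e \<in> E X"
    then obtain u where u: "u \<in> X" "e \<in> edges G" "u \<in> ends G e" by (auto simp: E_def)
    then obtain w where "ends G e = {u, w}" using edge_endsE[OF G u(2,3)] by metis
    with u nb[of u w] show "e \<in> E Y" by (auto simp: E_def adjacent_def)
  qed
  have finE: "finite (E Y)" using fin by (auto simp: E_def intro: finite_subset)
  have le: "card X * r \<le> card Y * r" using card_mono[OF finE sub] cX cY by linarith
  with r(2) show "card X \<le> card Y" by (metis mult_le_cancel2 less_le_trans zero_less_one)
  assume eq: "card X = card Y" and v: "v \<in> Y" "adjacent G v u"
  have "E X = E Y" using card_seteq[OF finE sub] cX cY eq by simp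
  moreover obtain e where e: "e \<in> edges G" "ends G e = {v, u}" using v by (auto simp: adjacent_def)
  ultimately have "e \<in> E X" using v by (auto simp: E_def)
  with e v XY(3) show "u \<in> X" by (auto simp: E_def)
qed

text \<open>In the equality case both sides send all their edges to each other, so the nonempty set
  \<open>X \<union> Y\<close> is closed under adjacency and is the whole connected graph.\<close>

lemma regular_neighbourhood_bipartite:
  assumes G: "loopless_graph G" "connected_graph G" and r: "regular r G" "r \<ge> 1"
    and XY: "X \<subseteq> verts G" "Y \<subseteq> verts G" "X \<inter> Y = {}"
    and nb: "\<And>u v. u \<in> X \<Longrightarrow> adjacent G u v \<Longrightarrow> v \<in> Y"
    and card: "card X = card Y" and ne: "X \<union> Y \<noteq> {}"
  shows "bipartite G"
proof -
  have rev: "u \<in> X" if "v \<in> Y" "adjacent G v u" for u v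
    by (rule regular_neighbourhood(2)[OF G(1) r XY _ card that]) (rule nb)
  obtain u where u: "u \<in> X \<union> Y" using ne by auto
  have "v \<in> X \<union> Y" if "(adjacent G)\<^sup>*\<^sup>* u v" for v
    using that
  proof (induction rule: rtranclp_induct)
    case base
    show ?case using u .
  next
    case (step v w)
    from step.IH show ?case
    proof
      assume "v \<in> X"
      from nb[OF this step.hyps(2)] show ?thesis ..
    next
      assume "v \<in> Y"
      from rev[OF this step.hyps(2)] show ?thesis ..
    qed
  qed
  moreover have "(adjacent G)\<^sup>*\<^sup>* u v" if "v \<in> verts G" for v
    using G(2) u XY(1,2) that unfolding connected_graph_def by blast
  ultimately have V: "X \<union> Y = verts G" using XY(1,2) by blast
  have "\<exists>x\<in>X. \<exists>y\<in>Y. ends G e = {x, y}" if e: "e \<in> edges G" for e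
  proof -
    obtain a b where ab: "ends G e = {a, b}" using e by (rule edge_pairE[OF G(1)])
    then have adj: "adjacent G a b" using e by (auto simp: adjacent_def)
    from V adjacentD(2)[OF G(1) adj] have "a \<in> X \<or> a \<in> Y" by auto
    then show ?thesis
    proof
      assume "a \<in> X"
      then have "b \<in> Y" using adj by (rule nb)
      show ?thesis by (intro bexI) (rule ab, fact+)
    next
      assume "a \<in> Y"
      then have "b \<in> X" using adj by (rule rev)
      have "ends G e = {b, a}" unfolding ab by (rule insert_commute)
      show ?thesis by (intro bexI) fact+
    qed
  qed
  then have "\<forall>e\<in>edges G. \<exists>x\<in>X. \<exists>y\<in>Y. ends G e = {x, y}" ..
  with V XY(3) have "X \<union> Y = verts G \<and> X \<inter> Y = {} \<and> (\<forall>e\<in>edges G. \<exists>x\<in>X. \<exists>y\<in>Y. ends G e = {x, y})"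
    by (intro conjI)
  then show ?thesis unfolding bipartite_def by (intro exI)
qed

section \<open>Independent sets measured against D, A and C\<close>

definition isolated_D :: "('v, 'e) mgraph \<Rightarrow> 'v set" where
  "isolated_D G = {v \<in> D_part G. \<forall>u\<in>D_part G. \<not> adjacent G v u}"

text \<open>The last term pays for the trivial classes: a single vertex belonging to
  \<open>I\<close> exceeds the bound for nontrivial classes by exactly this amount.\<close>

lemma D_class_independent:
  assumes G: "loopless_graph G" and S: "S \<in> D_classes G" and I: "independent_set G I"
  shows "2 * card (I \<inter> S) + 1 \<le> card S + 2 * card (I \<inter> isolated_D G \<inter> S)"
proof (cases "nontrivial (induced_subgraph G S)")
  case True
  from nontrivial_D_class_independent[OF G S True I] show ?thesis by simp
next
  case False
  obtain u where u: "u \<in> S" using D_class_nonempty[OF S] by auto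
  then have "S = {u}" using trivial_D_class[OF G S False] by auto
  moreover have "u \<in> isolated_D G"
    using D_class_subset[OF S] D_class_closed[OF S u] u False
    unfolding isolated_D_def nontrivial_induced_iff[OF G] by blast
  ultimately have "I \<inter> isolated_D G \<inter> S = I \<inter> S" "card S = 1" by auto
  then show ?thesis by simp
qed

text \<open>The bounds for the classes are summed over the partition of D; equality of the sums
  forces equality in every summand.\<close>

lemma D_part_independent:
  assumes G: "loopless_graph G" and I: "independent_set G I"
  shows "2 * card (I \<inter> D_part G) + card (D_classes G) \<le> card (D_part G) + 2 * card (I \<inter> isolated_D G)"
    and "2 * card (I \<inter> D_part G) + card (D_classes G) = card (D_part G) + 2 * card (I \<inter> isolated_D G) \<Longrightarrow>
      S \<in> D_classes G \<Longrightarrow> 2 * card (I \<inter> S) + 1 = card S + 2 * card (I \<inter> isolated_D G \<inter> S)"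
proof -
  let ?f = "\<lambda>S. 2 * card (I \<inter> S) + 1" and ?g = "\<lambda>S. card S + 2 * card (I \<inter> isolated_D G \<inter> S)"
  have "I \<inter> isolated_D G \<inter> D_part G = I \<inter> isolated_D G" by (auto simp: isolated_D_def)
  then have g: "sum ?g (D_classes G) = card (D_part G) + 2 * card (I \<inter> isolated_D G)"
    using sum_card_D_classes[OF G, of UNIV] sum_card_D_classes[OF G, of "I \<inter> isolated_D G"]
    by (simp add: sum.distrib sum_distrib_left[symmetric])
  have f: "sum ?f (D_classes G) = 2 * card (I \<inter> D_part G) + card (D_classes G)"
    using sum_card_D_classes[OF G, of I] by (simp only: sum.distrib sum_distrib_left[symmetric]) simp
  have le: "?f S \<le> ?g S" if "S \<in> D_classes G" for S
    using D_class_independent[OF G that I] .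
  from sum_mono[of "D_classes G" ?f ?g, OF le] f g
  show "2 * card (I \<inter> D_part G) + card (D_classes G) \<le> card (D_part G) + 2 * card (I \<inter> isolated_D G)"
    by simp
  assume "2 * card (I \<inter> D_part G) + card (D_classes G) = card (D_part G) + 2 * card (I \<inter> isolated_D G)"
    and S: "S \<in> D_classes G"
  with f g have "sum ?f (D_classes G) = sum ?g (D_classes G)" by simp
  from sum_mono_inv[OF this le S finite_D_classes[OF G]] show "?f S = ?g S" .
qed

lemma isolated_D_neighbour:
  assumes "loopless_graph G" "independent_set G I" "u \<in> I \<inter> isolated_D G" "adjacent G u v"
  shows "v \<in> A_part G - I"
  using assms adjacentD[OF assms(1,4)] adjacent_sym[OF assms(4)]
  by (auto simp: isolated_D_def A_part_def independent_set_def)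

text \<open>A maximum matching of the graph without A matches C perfectly within itself.\<close>

lemma C_part_independent:
  assumes G: "loopless_graph G" and I: "independent_set G I"
  shows "2 * card (I \<inter> C_part G) \<le> card (C_part G)"
proof -
  obtain M where M: "maximum_matching (induced_subgraph G (verts G - A_part G)) M"
    using maximum_matching_exists[OF loopless_induced[OF G]] by metis
  note MM = maximum_matching_delete_A_part[OF G M]
  from independent_in_matched(2)[OF G MM(1,4,5) I] show ?thesis by simp
qed

text \<open>Splitting \<open>I\<close> along C, A and D and adding the bounds for the pieces gives
  twice \<open>card I\<close> on one side and the right-hand side of the matching number formula on
  the other. Equality makes each bound used tight, which yields the remaining conclusions.\<close>

lemma independent_set_le_matching_number:
  assumes G: "loopless_graph G" and r: "regular r G" "r \<ge> 1" and I: "independent_set G I"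
  shows "card I \<le> matching_number G"
    and "card I = matching_number G \<Longrightarrow> 2 * card (I \<inter> C_part G) = card (C_part G)"
    and "card I = matching_number G \<Longrightarrow> card (I \<inter> isolated_D G) = card (A_part G - I)"
    and "card I = matching_number G \<Longrightarrow> S \<in> D_classes G \<Longrightarrow>
      2 * card (I \<inter> S) + 1 = card S + 2 * card (I \<inter> isolated_D G \<inter> S)"
proof -
  have fin: "finite (verts G)" using G by (simp add: loopless_graph_def)
  have IV: "I \<subseteq> verts G" using I by (simp add: independent_set_def)
  have sub: "D_part G \<subseteq> verts G" "A_part G \<subseteq> verts G" "C_part G \<subseteq> verts G"
    "isolated_D G \<subseteq> verts G" "D_part G \<inter> A_part G = {}" "isolated_D G \<inter> A_part G = {}"
    by (auto simp: D_part_def A_part_def C_part_def isolated_D_def)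
  have fins: "finite I" "finite (D_part G)" "finite (A_part G)" "finite (C_part G)"
    using fin IV sub by (meson finite_subset)+
  have "I = (I \<inter> C_part G) \<union> ((I \<inter> A_part G) \<union> (I \<inter> D_part G))"
    using IV by (auto simp: C_part_def)
  also have "card \<dots> = card (I \<inter> C_part G) + card ((I \<inter> A_part G) \<union> (I \<inter> D_part G))"
    using fins by (intro card_Un_disjoint) (auto simp: C_part_def)
  also have "card ((I \<inter> A_part G) \<union> (I \<inter> D_part G)) = card (I \<inter> A_part G) + card (I \<inter> D_part G)"
    using fins sub by (intro card_Un_disjoint) auto
  finally have cI: "card I = card (I \<inter> C_part G) + (card (I \<inter> A_part G) + card (I \<inter> D_part G))" .
  have "A_part G = (I \<inter> A_part G) \<union> (A_part G - I)" by auto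
  also have "card \<dots> = card (I \<inter> A_part G) + card (A_part G - I)"
    using fins by (intro card_Un_disjoint) auto
  finally have cA: "card (A_part G) = card (I \<inter> A_part G) + card (A_part G - I)" .
  \<comment> \<open>The vertices of A outside \<open>I\<close> make room for the trivial components
    chosen by \<open>I\<close>, whose neighbours all lie there. Regularity enters here.\<close>
  have T: "card (I \<inter> isolated_D G) \<le> card (A_part G - I)"
    by (rule regular_neighbourhood(1)[OF G r])
      (use IV sub isolated_D_neighbour[OF G I] in auto)
  note C = C_part_independent[OF G I] and D = D_part_independent[OF G I]
  note mu = matching_number_formula[OF G]
  from cI cA T C D(1) mu show "card I \<le> matching_number G" by linarith
  assume eq: "card I = matching_number G"
  from eq cI cA T C D(1) mu show "2 * card (I \<inter> C_part G) = card (C_part G)" by linarith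
  from eq cI cA T C D(1) mu show "card (I \<inter> isolated_D G) = card (A_part G - I)" by linarith
  assume "S \<in> D_classes G"
  moreover from eq cI cA T C D(1) mu
  have "2 * card (I \<inter> D_part G) + card (D_classes G) = card (D_part G) + 2 * card (I \<inter> isolated_D G)"
    by linarith
  ultimately show "2 * card (I \<inter> S) + 1 = card S + 2 * card (I \<inter> isolated_D G \<inter> S)"
    using D(2) by blast
qed

section \<open>The independence number and its lower bounds by \<mu>(G)\<close>

lemma finite_independent_sets: "loopless_graph G \<Longrightarrow> finite {I. independent_set G I}"
  by (rule finite_subset[of _ "Pow (verts G)"]) (auto simp: loopless_graph_def independent_set_def)

lemma card_independent_le:
  "loopless_graph G \<Longrightarrow> independent_set G I \<Longrightarrow> card I \<le> independence_number G"
  unfolding independence_number_def using finite_independent_sets by (intro Max_ge) auto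

lemma maximum_independent_set_exists:
  assumes "loopless_graph G"
  obtains I where "maximum_independent_set G I"
proof -
  have "independent_set G {}" by (simp add: independent_set_def)
  then have "Max (card ` {I. independent_set G I}) \<in> card ` {I. independent_set G I}"
    using finite_independent_sets[OF assms] by (intro Max_in) auto
  then show thesis using that by (auto simp: maximum_independent_set_def independence_number_def)
qed

text \<open>A maximum matching covers 2\<mu> vertices, and the two colour classes, both independent,
  have at most 2\<alpha> vertices together.\<close>

lemma bipartite_matching_number_le:
  assumes G: "loopless_graph G" and "bipartite G"
  shows "matching_number G \<le> independence_number G"
proof -
  from assms(2) obtain X Y where *: "X \<union> Y = verts G \<and> X \<inter> Y = {} \<and>
      (\<forall>e\<in>edges G. \<exists>x\<in>X. \<exists>y\<in>Y. ends G e = {x, y})"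
    unfolding bipartite_def by (elim exE)
  then have XY: "X \<union> Y = verts G" "X \<inter> Y = {}" by simp_all
  note e = *[THEN conjunct2, THEN conjunct2]
  have "\<not> adjacent G u v" if uv: "u \<in> X \<and> v \<in> X \<or> u \<in> Y \<and> v \<in> Y" for u v
  proof
    assume "adjacent G u v"
    then obtain f where f: "f \<in> edges G" "ends G f = {u, v}" by (auto simp: adjacent_def)
    from bspec[OF e f(1)] obtain x where x: "x \<in> X" "\<exists>y\<in>Y. ends G f = {x, y}" by (rule bexE)
    from x(2) obtain y where y: "y \<in> Y" "ends G f = {x, y}" by (rule bexE)
    have "u = x \<and> v = y \<or> u = y \<and> v = x" using y(2) unfolding f(2) doubleton_eq_iff .
    then show False
    proof (elim disjE conjE)
      assume "u = x" "v = y"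
      with uv x(1) y(1) XY(2) show False by auto
    next
      assume "u = y" "v = x"
      with uv x(1) y(1) XY(2) show False by auto
    qed
  qed
  then have "independent_set G X" "independent_set G Y"
    unfolding independent_set_def XY(1)[symmetric] by (intro conjI ballI; simp)+
  then have le: "card X \<le> independence_number G" "card Y \<le> independence_number G"
    using card_independent_le[OF G] by auto
  obtain M where M: "matching G M" "card M = matching_number G"
    using maximum_matching_exists[OF G] by (auto simp: maximum_matching_def)
  have "2 * matching_number G = card (covered G M)" using card_covered[OF G M(1)] M(2) by simp
  also have "\<dots> \<le> card (X \<union> Y)"
    unfolding XY(1) using covered_subset_verts[OF G M(1)] G
    by (intro card_mono) (auto simp: loopless_graph_def)
  also have "\<dots> \<le> card X + card Y" by (rule card_Un_le)
  finally show ?thesis using le by linarith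
qed

lemma independent_set_induced_iff:
  "independent_set (induced_subgraph G S) I \<longleftrightarrow> independent_set G I \<and> I \<subseteq> S"
  unfolding independent_set_def adjacent_induced_iff verts_induced by blast

lemma edges_between_empty_iff:
  "edges_between G S T = {} \<longleftrightarrow> (\<forall>s\<in>S. \<forall>t\<in>T. \<not> adjacent G s t)"
  by (simp add: edges_between_def adjacent_def) metis

text \<open>The witness is the trace of \<open>I\<close> on \<open>S\<close>. It has the largest
  size that factor-criticality permits, and it sends no edge to A because A lies in the same
  independent set \<open>I\<close>.\<close>

lemma good_componentI:
  assumes G: "loopless_graph G" and I: "independent_set G I" and A: "A_part G \<subseteq> I"
    and S: "S \<in> D_classes G" and nt: "nontrivial (induced_subgraph G S)"
    and card: "2 * card (I \<inter> S) + 1 = card S"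
  shows "good_component G (induced_subgraph G S)"
proof -
  let ?H = "induced_subgraph G S"
  have IS: "independent_set ?H (I \<inter> S)"
    using I unfolding independent_set_induced_iff by (simp add: independent_set_def subset_iff)
  obtain J where J: "independent_set ?H J" "card J = independence_number ?H"
    using maximum_independent_set_exists[OF loopless_induced[OF G]]
    unfolding maximum_independent_set_def by metis
  then have "independent_set G J" "J \<inter> S = J" by (auto simp: independent_set_induced_iff)
  with nontrivial_D_class_independent[OF G S nt, of J] J(2)
  have "2 * independence_number ?H + 1 \<le> card S" by simp
  with card_independent_le[OF loopless_induced[OF G] IS] card
  have \<alpha>: "card (I \<inter> S) = independence_number ?H" by simp
  have "verts ?H = S" using D_class_subset[OF S] D_part_subset[of G] by auto
  moreover have "real (card S) = 2 * real (card (I \<inter> S)) + 1" using card by linarith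
  ultimately have "real (independence_number ?H) = (real (card (verts ?H)) - 1) / 2"
    using \<alpha> by simp
  moreover have "edges_between G (I \<inter> S) (A_part G) = {}"
    using I A unfolding edges_between_empty_iff independent_set_def by blast
  ultimately show ?thesis
    using IS \<alpha> nt unfolding good_component_def maximum_independent_set_def by blast
qed

text \<open>A together with the sets I(D_i) supplied by the good components is independent, and with
  C empty its size is exactly the value of the matching number formula.\<close>

lemma matching_number_le_if_good:
  assumes G: "loopless_graph G" and C: "C_part G = {}"
    and A: "independent_set G (A_part G)"
    and good: "\<And>S. S \<in> D_classes G \<Longrightarrow> nontrivial (induced_subgraph G S) \<Longrightarrow>
      good_component G (induced_subgraph G S)"
  shows "matching_number G \<le> independence_number G"
proof -
  have "\<exists>I. independent_set G I \<and> I \<subseteq> S \<and> 2 * card I + 1 = card S \<and>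
      (\<forall>u\<in>I. \<forall>v\<in>A_part G. \<not> adjacent G u v)" if S: "S \<in> D_classes G" for S
  proof (cases "nontrivial (induced_subgraph G S)")
    case True
    then obtain I where I: "maximum_independent_set (induced_subgraph G S) I"
      "edges_between G I (A_part G) = {}"
      and \<alpha>: "real (independence_number (induced_subgraph G S)) =
        (real (card (verts (induced_subgraph G S))) - 1) / 2"
      using good[OF S] by (auto simp: good_component_def)
    have "verts G \<inter> S = S" using D_class_subset[OF S] D_part_subset[of G] by auto
    with \<alpha> I have "2 * real (card I) + 1 = real (card S)"
      by (simp add: maximum_independent_set_def field_simps)
    then have "2 * card I + 1 = card S" by linarith
    then show ?thesis
      using I unfolding maximum_independent_set_def independent_set_induced_iff
        edges_between_empty_iff by blast
  next
    case False
    obtain u where "u \<in> S" using D_class_nonempty[OF S] by auto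
    then have "S = {u}" by (rule trivial_D_class[OF G S False])
    \<comment> \<open>A trivial component contributes (1 - 1)/2 = 0 vertices, so the empty set fits
      the same equation.\<close>
    then show ?thesis by (intro exI[of _ "{}"]) (auto simp: independent_set_def)
  qed
  then have "\<forall>S\<in>D_classes G. \<exists>I. independent_set G I \<and> I \<subseteq> S \<and> 2 * card I + 1 = card S \<and>
      (\<forall>u\<in>I. \<forall>v\<in>A_part G. \<not> adjacent G u v)" ..
  from bchoice[OF this] obtain f where *: "\<forall>S\<in>D_classes G. independent_set G (f S) \<and> f S \<subseteq> S \<and>
      2 * card (f S) + 1 = card S \<and> (\<forall>u\<in>f S. \<forall>v\<in>A_part G. \<not> adjacent G u v)"
    by (rule exE)
  have f: "independent_set G (f S)" "f S \<subseteq> S" "2 * card (f S) + 1 = card S"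
    "\<And>u v. u \<in> f S \<Longrightarrow> v \<in> A_part G \<Longrightarrow> \<not> adjacent G u v" if "S \<in> D_classes G" for S
    using bspec[OF * that] by simp_all
  define F where "F = (\<Union>S\<in>D_classes G. f S)"
  have FD: "F \<subseteq> D_part G" unfolding F_def using f(2) D_class_subset by blast
  have FS: "F \<inter> S = f S" if S: "S \<in> D_classes G" for S
  proof -
    have "x \<in> f S" if "x \<in> f S'" "S' \<in> D_classes G" "x \<in> S" for x S'
    proof -
      have "x \<in> S'" using f(2)[OF that(2)] that(1) by auto
      then have "S' = S" using D_classes_disjoint[OF S that(2)] that(3) by auto
      with that show ?thesis by simp
    qed
    then show ?thesis using f(2)[OF S] S unfolding F_def by blast
  qed
  have F: "independent_set G F"
    unfolding independent_set_def
  proof (intro conjI ballI notI)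
    show "F \<subseteq> verts G" using FD D_part_subset[of G] by auto
    fix u v assume uv: "u \<in> F" "v \<in> F" "adjacent G u v"
    then obtain S where S: "S \<in> D_classes G" "u \<in> f S" by (auto simp: F_def)
    then have "u \<in> S" using f(2) by auto
    then have "v \<in> S" using D_class_closed[OF S(1) _ _ uv(3)] uv(2) FD by auto
    then have "v \<in> f S" using FS[OF S(1)] uv(2) by auto
    with f(1)[OF S(1)] S(2) uv(3) show False by (auto simp: independent_set_def)
  qed
  have FA: "\<not> adjacent G u v" if "u \<in> F" "v \<in> A_part G" for u v
    using that f(4) unfolding F_def by blast
  \<comment> \<open>The intersection with \<open>UNIV\<close> puts the class sizes into the form
    summed by \<open>sum_card_D_classes\<close>.\<close>
  have "(\<Sum>S\<in>D_classes G. 2 * card (F \<inter> S) + 1) = (\<Sum>S\<in>D_classes G. card (UNIV \<inter> S))"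
    using f(3) FS by (intro sum.cong) simp_all
  then have "2 * card (F \<inter> D_part G) + card (D_classes G) = card (D_part G)"
    using sum_card_D_classes[OF G, of UNIV] sum_card_D_classes[OF G, of F]
    by (simp only: sum.distrib sum_distrib_left[symmetric]) simp
  moreover have "F \<inter> D_part G = F" using FD by auto
  ultimately have cF: "2 * card F + card (D_classes G) = card (D_part G)" by simp
  have "independent_set G (A_part G \<union> F)"
    using A F FA adjacent_sym[of G] unfolding independent_set_def by blast
  then have "card (A_part G \<union> F) \<le> independence_number G" by (rule card_independent_le[OF G])
  moreover have "card (A_part G \<union> F) = card (A_part G) + card F"
    using FD finite_D_part[OF G] G
    by (intro card_Un_disjoint) (auto simp: A_part_def loopless_graph_def intro: finite_subset)
  ultimately show ?thesis using cF matching_number_formula[OF G] C by simp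
qed

section \<open>Equality of \<alpha>(G) and \<mu>(G)\<close>

theorem theorem6:
  fixes G :: "('v, 'e) mgraph" and r :: nat
  assumes "r \<ge> 3"
    and "loopless_graph G"
    and "connected_graph G"
    and "regular r G"
  shows "independence_number G = matching_number G \<longleftrightarrow>
    bipartite G \<or>
    (C_part G = {} \<and>
     (\<forall>I. maximum_independent_set G I \<longrightarrow> A_part G \<subseteq> I) \<and>
     (\<forall>H\<in>components (induced_subgraph G (D_part G)). nontrivial H \<longrightarrow> good_component G H))"
    (is "?eq \<longleftrightarrow> bipartite G \<or> ?GE")
proof -
  note G = assms(2,3)
  have r: "regular r G" "r \<ge> 1" using assms by auto
  obtain I0 where I0: "maximum_independent_set G I0" using maximum_independent_set_exists[OF G(1)] .
  have le: "independence_number G \<le> matching_number G"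
    using I0 independent_set_le_matching_number(1)[OF G(1) r, of I0]
    by (simp add: maximum_independent_set_def)
  have GE: ?GE if ?eq and nb: "\<not> bipartite G"
  proof -
    have AI: "A_part G \<subseteq> I \<and> I \<inter> isolated_D G = {}" if "maximum_independent_set G I" for I
    proof -
      have I: "independent_set G I" "card I = matching_number G"
        using that \<open>?eq\<close> by (auto simp: maximum_independent_set_def)
      \<comment> \<open>The two sets have equal size, and all neighbours of the first lie in the
        second. Unless both are empty, \<open>G\<close> is bipartite with these as its sides.
        Emptiness gives condition (ii) and also that \<open>I\<close> avoids the trivial
        components.\<close>
      have "(I \<inter> isolated_D G) \<union> (A_part G - I) = {}"
      proof (rule ccontr)
        assume "(I \<inter> isolated_D G) \<union> (A_part G - I) \<noteq> {}"
        moreover have "I \<inter> isolated_D G \<subseteq> verts G" using I(1) by (auto simp: independent_set_def)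
        moreover have "A_part G - I \<subseteq> verts G" by (auto simp: A_part_def)
        moreover have "(I \<inter> isolated_D G) \<inter> (A_part G - I) = {}" by auto
        ultimately have "bipartite G"
          using independent_set_le_matching_number(3)[OF G(1) r I]
            isolated_D_neighbour[OF G(1) I(1)]
          by (intro regular_neighbourhood_bipartite[OF G r, of "I \<inter> isolated_D G" "A_part G - I"])
        with nb show False ..
      qed
      then show ?thesis by auto
    qed
    have I: "independent_set G I0" "card I0 = matching_number G"
      using I0 \<open>?eq\<close> by (auto simp: maximum_independent_set_def)
    note AI0 = AI[OF I0]
    have "C_part G = {}"
    proof (rule ccontr)
      assume ne: "C_part G \<noteq> {}"
      \<comment> \<open>A neighbour of a vertex of C is never in D, and here it is not in A either,
        since A is contained in \<open>I0\<close>. As \<open>I0\<close> takes exactly half of C, the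
        two halves form a balanced pair again.\<close>
      have nbC: "v \<in> C_part G - I0" if u: "u \<in> I0 \<inter> C_part G" and uv: "adjacent G u v" for u v
      proof -
        have "v \<notin> I0" using u uv I(1) by (auto simp: independent_set_def)
        moreover have "v \<notin> D_part G" using u uv by (auto simp: C_part_def A_part_def)
        moreover have "v \<in> verts G" using adjacentD[OF G(1) uv] by simp
        ultimately show ?thesis using AI0 by (auto simp: C_part_def)
      qed
      have "finite (C_part G)" using G(1) by (simp add: C_part_def loopless_graph_def)
      then have "card (C_part G - I0) = card (C_part G) - card (I0 \<inter> C_part G)"
        by (simp add: card_Diff_subset_Int Int_commute)
      then have "card (I0 \<inter> C_part G) = card (C_part G - I0)"
        using independent_set_le_matching_number(2)[OF G(1) r I] by simp
      moreover have "I0 \<inter> C_part G \<subseteq> verts G" "C_part G - I0 \<subseteq> verts G" by (auto simp: C_part_def)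
      moreover have "(I0 \<inter> C_part G) \<inter> (C_part G - I0) = {}" by auto
      moreover have "(I0 \<inter> C_part G) \<union> (C_part G - I0) \<noteq> {}" using ne by auto
      ultimately have "bipartite G"
        using nbC
        by (intro regular_neighbourhood_bipartite[OF G r, of "I0 \<inter> C_part G" "C_part G - I0"])
      with nb show False ..
    qed
    moreover have "good_component G H" if H: "H \<in> components (induced_subgraph G (D_part G))" and nt: "nontrivial H" for H
    proof -
      obtain S where S: "S \<in> D_classes G" "H = induced_subgraph G S"
        using H unfolding components_D_part by auto
      \<comment> \<open>The correction term vanishes because \<open>I0\<close> contains no vertex of
        a trivial component.\<close>
      have "2 * card (I0 \<inter> S) + 1 = card S"
        using AI0 independent_set_le_matching_number(4)[OF G(1) r I S(1)] by simp
      with nt AI0 show ?thesis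
        unfolding S(2) by (intro good_componentI[OF G(1) I(1) _ S(1)]) simp_all
    qed
    ultimately show ?thesis using AI by simp
  qed
  have ge: "matching_number G \<le> independence_number G" if ?GE
  proof (rule matching_number_le_if_good[OF G(1)])
    \<comment> \<open>Condition (ii) serves here only to show that A is independent, for which one
      maximum independent set suffices.\<close>
    have "A_part G \<subseteq> I0" using that I0 by simp
    then show "independent_set G (A_part G)"
      using I0 unfolding maximum_independent_set_def independent_set_def by blast
  qed (use that in \<open>simp_all add: components_D_part\<close>)
  show ?thesis
  proof
    assume ?eq
    then have "\<not> bipartite G \<longrightarrow> ?GE" by (intro impI GE)
    then show "bipartite G \<or> ?GE" unfolding imp_conv_disj not_not .
  next
    assume "bipartite G \<or> ?GE"
    then have "matching_number G \<le> independence_number G"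
      by (elim disjE) (rule bipartite_matching_number_le[OF G(1)], assumption, rule ge)
    with le show ?eq by (rule le_antisym)
  qed
qed

end
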